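(* Let $\lambda$ be a positive integer with $\gcd(\lambda,6)=1$, let $a\ge 2$ and $b\ge 0$ be integers, and let $n=\lambda\cdot 2^a\cdot 3^b-1$. Under the Collatz map, the next odd number in the trajectory of $n$ (after $n$ itself) is $\lambda\cdot 2^{a-1}\cdot 3^{b+1}-1$. That is, in skeleton coordinates, position $(a,b)$ maps to $(a-1,b+1)$.
   Context: The Collatz map is $C(n)=n/2$ if $n$ is even and $C(n)=3n+1$ if $n$ is odd; the trajectory of $n$ is $n,C(n),C(C(n)),\dots$. For a positive integer $\lambda$ coprime to $6$, the odd skeleton is $\mathcal{L}_\lambda=\{\lambda\cdot 2^a\cdot 3^b-1: a\ge 1,\ b\ge 0\}$, and the element $\lambda\cdot 2^a\cdot 3^b-1$ has skeleton coordinates (position) $(a,b)$. *)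

theory Defs
  imports Main
begin

definition collatz :: "nat \<Rightarrow> nat" where
  "collatz n = (if even n then n div 2 else 3 * n + 1)"

text \<open>The trajectory of \<open>n\<close> is \<open>k \<mapsto> (collatz ^^ k) n\<close>. The predicate below says that \<open>m\<close> is the
  first odd term of the trajectory strictly after the initial term \<open>n\<close>; by minimality of \<open>k\<close>,
  there is at most one such \<open>m\<close>.\<close>

definition next_odd_in_trajectory :: "nat \<Rightarrow> nat \<Rightarrow> bool" where
  "next_odd_in_trajectory n m \<longleftrightarrow>
     (\<exists>k\<ge>1. (collatz ^^ k) n = m \<and> odd m \<and> (\<forall>j. 1 \<le> j \<and> j < k \<longrightarrow> even ((collatz ^^ j) n)))"

text \<open>For \<open>l > 0\<close> the product \<open>l * 2 ^ a * 3 ^ b\<close> is positive, so the subtraction on \<open>nat\<close> is exact.\<close>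

definition odd_skeleton :: "nat \<Rightarrow> nat set" where
  "odd_skeleton l = {l * 2 ^ a * 3 ^ b - 1 | a b. a \<ge> 1}"

text \<open>Meaningful only for \<open>l > 0\<close> and \<open>m \<in> odd_skeleton l\<close>, where the pair is uniquely determined.\<close>

definition skeleton_coords :: "nat \<Rightarrow> nat \<Rightarrow> nat \<times> nat" where
  "skeleton_coords l m = (THE (a, b). a \<ge> 1 \<and> m = l * 2 ^ a * 3 ^ b - 1)"

end

theory Submission
  imports Defs
begin

text \<open>
  Put \<open>N = l * 2 ^ (a - 1) * 3 ^ b\<close>, so that \<open>n = 2 * N - 1\<close>. This is odd, so the map sends it to
  \<open>3 * (2 * N - 1) + 1 = 2 * (3 * N - 1)\<close>, and one halving gives \<open>3 * N - 1\<close>: adding \<open>1\<close> to both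
  ends turns the two steps into multiplication by \<open>3 / 2\<close>. The hypothesis \<open>a \<ge> 2\<close> says that \<open>N\<close> is
  still even, so \<open>3 * N - 1\<close> is odd and the descent stops after this single halving
  (\<open>next_odd_double_minus_one\<close>). Multiplying by \<open>3 / 2\<close> moves one factor \<open>2\<close> to a factor \<open>3\<close>, which
  is the shift from \<open>(a, b)\<close> to \<open>(a - 1, b + 1)\<close>. That these pairs are the coordinates of the two
  numbers rests on unique factorisation in the weak form \<open>odd_two_three_exponents_unique\<close>.
\<close>

lemma next_odd_double_minus_one:
  assumes "even N" and "N > 0"
  shows "next_odd_in_trajectory (2 * N - 1) (3 * N - 1)"
proof -
  have "odd (2 * N - 1)" using assms by simp
  moreover have "3 * (2 * N - 1) + 1 = 2 * (3 * N - 1)" using assms by simp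
  ultimately have first: "collatz (2 * N - 1) = 2 * (3 * N - 1)"
    by (simp add: collatz_def)
  have "collatz (2 * (3 * N - 1)) = 3 * N - 1"
    by (simp add: collatz_def del: mult_Suc_right right_diff_distrib')
  with first have "collatz (collatz (2 * N - 1)) = 3 * N - 1" by (simp only:)
  then have "(collatz ^^ 2) (2 * N - 1) = 3 * N - 1"
    unfolding numeral_2_eq_2 funpow.simps o_apply id_apply .
  moreover have "odd (3 * N - 1)" using assms by simp
  moreover have "even ((collatz ^^ j) (2 * N - 1))" if "1 \<le> j \<and> j < 2" for j
  proof -
    have "j = 1" using that by simp
    then show ?thesis using first by simp
  qed
  ultimately show ?thesis
    unfolding next_odd_in_trajectory_def by (intro exI[of _ 2]) auto
qed

lemma odd_times_two_power_exponent_le: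
  fixes x y :: nat
  assumes "odd y" and "x * 2 ^ a = y * 2 ^ c"
  shows "a \<le> c"
proof (rule ccontr)
  assume "\<not> a \<le> c"
  then have "2 ^ a = 2 ^ c * (2 ^ (a - c) :: nat)"
    by (simp flip: power_add)
  with assms(2) have "y = x * 2 ^ (a - c)" by simp
  with \<open>\<not> a \<le> c\<close> have "even y" by simp
  with assms(1) show False by simp
qed

text \<open>
  Since \<open>l\<close> is odd, all factors \<open>2\<close> sit in the explicit powers, which must therefore agree. The
  common cofactor \<open>l\<close> then cancels, and injectivity of \<open>k \<mapsto> 3 ^ k\<close> finishes.
\<close>
lemma odd_two_three_exponents_unique:
  fixes l :: nat
  assumes "odd l" and eq: "l * 2 ^ a * 3 ^ b = l * 2 ^ c * 3 ^ d"
  shows "a = c \<and> b = d"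
proof -
  have eq': "(l * 3 ^ b) * 2 ^ a = (l * 3 ^ d) * 2 ^ c"
    using eq by (simp add: ac_simps)
  have "a \<le> c"
    by (rule odd_times_two_power_exponent_le[OF _ eq']) (use \<open>odd l\<close> in simp)
  moreover have "c \<le> a"
    by (rule odd_times_two_power_exponent_le[OF _ eq'[symmetric]]) (use \<open>odd l\<close> in simp)
  ultimately have "a = c" by simp
  moreover have "l > 0" using \<open>odd l\<close> by (rule odd_pos)
  ultimately show ?thesis using eq by simp
qed

lemma skeleton_coords_eq:
  assumes "odd l" and "a \<ge> 1"
  shows "skeleton_coords l (l * 2 ^ a * 3 ^ b - 1) = (a, b)"
  unfolding skeleton_coords_def
proof (rule the_equality, goal_cases)
  case 1
  show ?case using assms by simp
next
  case (2 p)
  obtain c d where p: "p = (c, d)" by (cases p)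
  have "l > 0" using \<open>odd l\<close> by (rule odd_pos)
  \<comment> \<open>Positivity of both products makes truncated subtraction of \<open>1\<close> injective.\<close>
  then have "l * 2 ^ a * 3 ^ b > 0" and "l * 2 ^ c * 3 ^ d > 0" by simp_all
  moreover have "l * 2 ^ a * 3 ^ b - 1 = l * 2 ^ c * 3 ^ d - 1" using 2 p by simp
  ultimately have "l * 2 ^ a * 3 ^ b = l * 2 ^ c * 3 ^ d" by linarith
  with \<open>odd l\<close> show ?case using odd_two_three_exponents_unique p by blast
qed

theorem theorem3p6:
  fixes l a b n :: nat
  assumes "l > 0" and "gcd l 6 = 1"
    and "a \<ge> 2"
    and "n = l * 2 ^ a * 3 ^ b - 1"
  shows "next_odd_in_trajectory n (l * 2 ^ (a - 1) * 3 ^ (b + 1) - 1) \<and>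
    n \<in> odd_skeleton l \<and> skeleton_coords l n = (a, b) \<and>
    (\<exists>m \<in> odd_skeleton l. next_odd_in_trajectory n m \<and> skeleton_coords l m = (a - 1, b + 1))"
proof -
  have "odd l"
  proof
    assume "even l"
    then have "2 dvd gcd l 6" by simp
    with assms(2) show False by simp
  qed
  define N where "N = l * 2 ^ (a - 1) * 3 ^ b"
  define m where "m = l * 2 ^ (a - 1) * 3 ^ (b + 1) - 1"
  have "even N" and "N > 0" using assms(1,3) by (simp_all add: N_def)
  moreover have "n = 2 * N - 1"
    using assms(3,4) by (cases a) (simp_all add: N_def ac_simps)
  moreover have "m = 3 * N - 1" by (simp add: m_def N_def ac_simps)
  ultimately have next_odd: "next_odd_in_trajectory n m"
    using next_odd_double_minus_one by simp
  have "a \<ge> 1" and "a - 1 \<ge> 1" using assms(3) by simp_all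
  then have "n \<in> odd_skeleton l" and "m \<in> odd_skeleton l"
    unfolding odd_skeleton_def assms(4) m_def by blast+
  moreover have "skeleton_coords l n = (a, b)"
    unfolding assms(4) using \<open>odd l\<close> \<open>a \<ge> 1\<close> by (rule skeleton_coords_eq)
  moreover have "skeleton_coords l m = (a - 1, b + 1)"
    unfolding m_def using \<open>odd l\<close> \<open>a - 1 \<ge> 1\<close> by (rule skeleton_coords_eq)
  ultimately show ?thesis using next_odd unfolding m_def by blast
qed

end
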